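(* Let $X=\mathbb Z^n$ with an $l_p$-metric, $1\le p\le\infty$, and let $s\in M(X)$. Then $s^*s=\mathbf 1$ implies $ss^*=\mathbf 1$.
   Context: The inverse semigroup $M(X)$ of a metric space $(X,d_X)$: the double of $X$ is $X\sqcup X'$, where $X=X\times\{0\}$ and $X'=X\times\{1\}$ are two copies of $X$; write $x=(x,0)$ and $x'=(x,1)$. Let $\mathcal M(X)$ be the set of all metrics $d$ on $X\sqcup X'$ whose restriction to each of the two copies of $X$ is $d_X$ and which satisfy $\inf_{x,y\in X}d(x,y')>0$. Two metrics $b,d$ on a set $Z$ are coarsely equivalent if there are monotone functions $\varphi,\psi:[0,\infty)\to[0,\infty)$ with $\lim_{t\to\infty}\varphi(t)=\lim_{t\to\infty}\psi(t)=\infty$ such that $\varphi(d(z_1,z_2))\le b(z_1,z_2)\le\psi(d(z_1,z_2))$ for all $z_1,z_2\in Z$; $[d]$ denotes the coarse equivalence class of $d$. $M(X)$ is the set of coarse equivalence classes of metrics in $\mathcal M(X)$, with multiplication $[\rho][d]=[\rho\circ d]$, where $\rho\circ d\in\mathcal M(X)$ is determined by $(\rho\circ d)(x,z')=\inf_{y\in X}[d(x,y')+\rho(y,z')]$ for $x,z\in X$. It is known that this is well defined and that $M(X)$ is an inverse semigroup; the pseudo-inverse of $s=[d]$ is $s^*=[d^*]$ with $d^*(x,y')=d(x',y)$, and the unit $\mathbf 1$ is the class of the metric $d(x,y')=d_X(x,y)+1$. *)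

theory Defs
  imports "HOL-Analysis.Analysis"
begin

text \<open>
  The underlying set X of the metric space is a whole type \<open>'a\<close>, with metric \<open>dX\<close>. The double of X
  is the type \<open>'a + 'a\<close>: \<open>Inl x\<close> is the point x of the first copy, \<open>Inr x\<close> is the point x' of the
  second copy.
\<close>

type_synonym 'a double_dist = "'a + 'a \<Rightarrow> 'a + 'a \<Rightarrow> real"

definition double_metrics :: "('a \<Rightarrow> 'a \<Rightarrow> real) \<Rightarrow> 'a double_dist set" where
  "double_metrics dX = {d. Metric_space UNIV d \<and>
     (\<forall>x y. d (Inl x) (Inl y) = dX x y) \<and>
     (\<forall>x y. d (Inr x) (Inr y) = dX x y) \<and>
     (INF (x, y)\<in>UNIV. d (Inl x) (Inr y)) > 0}"

definition coarsely_equivalent :: "('z \<Rightarrow> 'z \<Rightarrow> real) \<Rightarrow> ('z \<Rightarrow> 'z \<Rightarrow> real) \<Rightarrow> bool" where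
  "coarsely_equivalent b d \<longleftrightarrow> (\<exists>\<phi> \<psi> :: real \<Rightarrow> real.
     \<phi> \<in> {0..} \<rightarrow> {0..} \<and> \<psi> \<in> {0..} \<rightarrow> {0..} \<and>
     mono_on {0..} \<phi> \<and> mono_on {0..} \<psi> \<and>
     filterlim \<phi> at_top at_top \<and> filterlim \<psi> at_top at_top \<and>
     (\<forall>z w. \<phi> (d z w) \<le> b z w \<and> b z w \<le> \<psi> (d z w)))"

definition coarse_rel :: "('a \<Rightarrow> 'a \<Rightarrow> real) \<Rightarrow> ('a double_dist \<times> 'a double_dist) set" where
  "coarse_rel dX = {(d, b). d \<in> double_metrics dX \<and> b \<in> double_metrics dX \<and>
     coarsely_equivalent b d}"

definition coarse_class :: "('a \<Rightarrow> 'a \<Rightarrow> real) \<Rightarrow> 'a double_dist \<Rightarrow> 'a double_dist set" where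
  "coarse_class dX d = coarse_rel dX `` {d}"

definition coarse_semigroup :: "('a \<Rightarrow> 'a \<Rightarrow> real) \<Rightarrow> 'a double_dist set set" where
  "coarse_semigroup dX = double_metrics dX // coarse_rel dX"

text \<open>
  The symmetric function on the double that is \<open>dX\<close> on both copies and whose value at (x, y') is
  \<open>c x y\<close>.
\<close>

fun extend_cross :: "('a \<Rightarrow> 'a \<Rightarrow> real) \<Rightarrow> ('a \<Rightarrow> 'a \<Rightarrow> real) \<Rightarrow> 'a double_dist" where
  "extend_cross dX c (Inl x) (Inl y) = dX x y"
| "extend_cross dX c (Inr x) (Inr y) = dX x y"
| "extend_cross dX c (Inl x) (Inr y) = c x y"
| "extend_cross dX c (Inr y) (Inl x) = c x y"

definition metric_comp ::
    "('a \<Rightarrow> 'a \<Rightarrow> real) \<Rightarrow> 'a double_dist \<Rightarrow> 'a double_dist \<Rightarrow> 'a double_dist" where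
  "metric_comp dX \<rho> d =
     extend_cross dX (\<lambda>x z. INF y. d (Inl x) (Inr y) + \<rho> (Inl y) (Inr z))"

definition metric_adj :: "('a \<Rightarrow> 'a \<Rightarrow> real) \<Rightarrow> 'a double_dist \<Rightarrow> 'a double_dist" where
  "metric_adj dX d = extend_cross dX (\<lambda>x y. d (Inr x) (Inl y))"

definition metric_unit :: "('a \<Rightarrow> 'a \<Rightarrow> real) \<Rightarrow> 'a double_dist" where
  "metric_unit dX = extend_cross dX (\<lambda>x y. dX x y + 1)"

text \<open>
  Operations on classes, as unions over representatives: since the operations respect
  coarse equivalence, all the classes in each union coincide.
\<close>

definition class_mult ::
    "('a \<Rightarrow> 'a \<Rightarrow> real) \<Rightarrow> 'a double_dist set \<Rightarrow> 'a double_dist set \<Rightarrow> 'a double_dist set" where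
  "class_mult dX s t = (\<Union>\<rho>\<in>s. \<Union>d\<in>t. coarse_class dX (metric_comp dX \<rho> d))"

definition class_star :: "('a \<Rightarrow> 'a \<Rightarrow> real) \<Rightarrow> 'a double_dist set \<Rightarrow> 'a double_dist set" where
  "class_star dX s = (\<Union>d\<in>s. coarse_class dX (metric_adj dX d))"

definition class_one :: "('a \<Rightarrow> 'a \<Rightarrow> real) \<Rightarrow> 'a double_dist set" where
  "class_one dX = coarse_class dX (metric_unit dX)"

definition lp_dist :: "ereal \<Rightarrow> int ^ 'n \<Rightarrow> int ^ 'n \<Rightarrow> real" where
  "lp_dist p x y =
     (if p = \<infinity> then MAX i. \<bar>real_of_int (x $ i - y $ i)\<bar>
      else (\<Sum>i\<in>UNIV. \<bar>real_of_int (x $ i - y $ i)\<bar> powr real_of_ereal p)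
             powr (1 / real_of_ereal p))"

end

theory Submission
  imports Defs
begin

text \<open>
  If s = [d] satisfies s*s = 1, then every x lies within bounded d-distance of some point (f x)' of the
  second copy, and f distorts distances by at most an additive constant. Such a map has coarsely
  dense image: suppose that y has a large distance r from the image of f, and let f x0 be within 2r
  of y. After composing f with a translation we may take x0 to be a fixed point. As in the proof that
  an isometric embedding of a compact space into itself is onto, many iterates of y are then r/2-separated,
  while they stay in a ball of radius 3r around x0; for large r this contradicts the doubling
  property. So every y' is within bounded distance of the first copy, which is what ss* = 1 needs.

  Minkowski's inequality for the lp-distance is never needed: the triangle inequality holds because
  the semigroup contains an element at all.
\<close>

section \<open>Coarse equivalence as mutual control of distances\<close>

definition controlled :: "('z \<Rightarrow> 'z \<Rightarrow> real) \<Rightarrow> ('z \<Rightarrow> 'z \<Rightarrow> real) \<Rightarrow> bool" where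
  "controlled b d \<longleftrightarrow> (\<forall>R. \<exists>S. \<forall>z w. d z w \<le> R \<longrightarrow> b z w \<le> S)"

lemma controlledD:
  assumes "controlled b d"
  obtains S where "\<And>z w. d z w \<le> R \<Longrightarrow> b z w \<le> S"
  using assms unfolding controlled_def by meson

lemma controlled_refl: "controlled d d"
  unfolding controlled_def by blast

lemma controlled_trans: "controlled a b \<Longrightarrow> controlled b d \<Longrightarrow> controlled a d"
  unfolding controlled_def by meson

lemma coarsely_equivalent_imp_controlled:
  assumes "coarsely_equivalent b d" and nonneg: "\<And>z w. 0 \<le> d z w"
  shows "controlled b d" "controlled d b"
proof -
  obtain \<phi> \<psi> :: "real \<Rightarrow> real" where
    "mono_on {0..} \<psi>" and lim: "filterlim \<phi> at_top at_top"
    and low: "\<And>z w. \<phi> (d z w) \<le> b z w" and up: "\<And>z w. b z w \<le> \<psi> (d z w)"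
    using assms(1) unfolding coarsely_equivalent_def by metis
  have "b z w \<le> \<psi> R" if "d z w \<le> R" for z w R
    using up[of z w] mono_onD[OF \<open>mono_on {0..} \<psi>\<close>, of "d z w" R] that nonneg[of z w] by simp
  then show "controlled b d"
    unfolding controlled_def by blast
  show "controlled d b"
    unfolding controlled_def
  proof
    fix R
    obtain S where S: "\<And>t. S \<le> t \<Longrightarrow> R < \<phi> t"
      using lim unfolding filterlim_at_top_dense eventually_at_top_linorder by blast
    have "d z w \<le> S" if "b z w \<le> R" for z w
      using S[of "d z w"] low[of z w] that by linarith
    then show "\<exists>S. \<forall>z w. b z w \<le> R \<longrightarrow> d z w \<le> S"
      by blast
  qed
qed

text \<open>Converse of the preceding lemma: the optimal bounds of \<open>b\<close> in terms of
  \<open>d\<close> serve as \<phi> and \<psi>. From here on coarse equivalence is handled only as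
  control in both directions.\<close>

lemma controlled_imp_coarsely_equivalent:
  assumes bd: "controlled b d" and db: "controlled d b"
    and b_nonneg: "\<And>z w. 0 \<le> b z w" and d_nonneg: "\<And>z w. 0 \<le> d z w"
  shows "coarsely_equivalent b d"
proof -
  \<comment> \<open>The inserted elements keep both sets nonempty: no pair need have
    \<open>d z w \<le> t\<close> when t is negative, or \<open>t \<le> d z w\<close> when d is
    bounded. Inserting t, rather than a constant, lets \<phi> still tend to infinity; for \<psi> the
    summand t does this.\<close>
  define U where "U t = insert 0 {b z w |z w. d z w \<le> t}" for t
  define L where "L t = insert t {b z w |z w. t \<le> d z w}" for t
  define \<psi> where "\<psi> t = t + Sup (U t)" for t
  define \<phi> where "\<phi> t = Inf (L t)" for t
  have U_bdd: "bdd_above (U t)" for t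
  proof -
    obtain S where "\<And>z w. d z w \<le> t \<Longrightarrow> b z w \<le> S"
      using controlledD[OF bd] by metis
    then have "\<forall>u\<in>U t. u \<le> max 0 S"
      unfolding U_def by fastforce
    then show ?thesis by (auto simp: bdd_above_def)
  qed
  have L_nonneg: "0 \<le> u" if "0 \<le> t" "u \<in> L t" for t u
    using that b_nonneg unfolding L_def by auto
  have L_bdd: "bdd_below (L t)" if "0 \<le> t" for t
    using L_nonneg[OF that] by (auto simp: bdd_below_def)
  have Sup_nonneg: "0 \<le> Sup (U t)" for t
    by (rule cSup_upper[OF _ U_bdd]) (simp add: U_def)
  have le_psi: "t \<le> \<psi> t" for t
    using Sup_nonneg[of t] by (simp add: \<psi>_def)
  have "\<psi> \<in> {0..} \<rightarrow> {0..}"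
    using le_psi by (auto intro: order_trans)
  moreover have "\<phi> \<in> {0..} \<rightarrow> {0..}"
    unfolding \<phi>_def using L_nonneg by (auto intro!: cInf_greatest simp: L_def)
  moreover have "mono_on {0..} \<psi>"
  proof (rule mono_onI)
    fix t u :: real assume "t \<le> u"
    then have "U t \<subseteq> U u" unfolding U_def by fastforce
    then have "Sup (U t) \<le> Sup (U u)"
      using cSup_subset_mono[OF _ U_bdd] by (auto simp: U_def)
    then show "\<psi> t \<le> \<psi> u" using \<open>t \<le> u\<close> by (simp add: \<psi>_def)
  qed
  moreover have "mono_on {0..} \<phi>"
  proof (rule mono_onI)
    fix t u :: real assume "t \<in> {0..}" "t \<le> u"
    \<comment> \<open>Apart from the inserted u, every element of \<open>L u\<close> already lies in
      \<open>L t\<close>; the inserted u dominates the inserted t.\<close>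
    have "Inf (L t) \<le> v" if "v \<in> L u" for v
    proof (cases "v = u")
      case True
      have "Inf (L t) \<le> t"
        using L_bdd \<open>t \<in> {0..}\<close> by (intro cInf_lower) (auto simp: L_def)
      then show ?thesis using True \<open>t \<le> u\<close> by simp
    next
      case False
      then have "v \<in> L t" using that \<open>t \<le> u\<close> unfolding L_def by fastforce
      then show ?thesis using L_bdd \<open>t \<in> {0..}\<close> by (intro cInf_lower) auto
    qed
    then show "\<phi> t \<le> \<phi> u"
      unfolding \<phi>_def by (intro cInf_greatest) (auto simp: L_def)
  qed
  moreover have "filterlim \<psi> at_top at_top"
    using le_psi by (intro filterlim_at_top_mono[OF filterlim_ident]) auto
  moreover have "filterlim \<phi> at_top at_top"
    unfolding filterlim_at_top eventually_at_top_linorder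
  proof
    fix S :: real
    obtain R where R: "\<And>z w. b z w \<le> S \<Longrightarrow> d z w \<le> R"
      using controlledD[OF db] by metis
    \<comment> \<open>The inserted value t is at least S outright. Any other element is some
      \<open>b z w\<close> with \<open>d z w > R\<close>, so it exceeds S by the choice of
      R.\<close>
    have "S \<le> \<phi> t" if "max S (R + 1) \<le> t" for t
      unfolding \<phi>_def
    proof (rule cInf_greatest)
      fix u assume "u \<in> L t"
      then consider "u = t" | z w where "u = b z w" "t \<le> d z w"
        unfolding L_def by auto
      then show "S \<le> u"
      proof cases
        case 2
        then show ?thesis using R[of z w] that by linarith
      qed (use that in auto)
    qed (simp add: L_def)
    then show "\<exists>N. \<forall>t\<ge>N. S \<le> \<phi> t" by blast
  qed
  moreover have "\<phi> (d z w) \<le> b z w" for z w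
    unfolding \<phi>_def using L_bdd[OF d_nonneg] by (intro cInf_lower) (auto simp: L_def)
  moreover have "b z w \<le> \<psi> (d z w)" for z w
  proof -
    have "b z w \<le> Sup (U (d z w))"
      by (rule cSup_upper[OF _ U_bdd]) (auto simp: U_def)
    then show ?thesis using d_nonneg[of z w] by (simp add: \<psi>_def)
  qed
  ultimately show ?thesis
    unfolding coarsely_equivalent_def by blast
qed

section \<open>Metrics on the double, their adjoints and compositions\<close>

lemma double_metrics_basic:
  assumes "d \<in> double_metrics dX"
  shows double_metrics_nonneg: "0 \<le> d z w"
    and double_metrics_commute: "d z w = d w z"
    and double_metrics_triangle: "d z u \<le> d z w + d w u"
    and double_metrics_eq_0: "d z w = 0 \<longleftrightarrow> z = w"
    and double_metrics_Inl: "d (Inl x) (Inl y) = dX x y"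
    and double_metrics_Inr: "d (Inr x) (Inr y) = dX x y"
proof -
  interpret Metric_space UNIV d
    using assms by (simp add: double_metrics_def)
  show "0 \<le> d z w" "d z w = d w z" "d z u \<le> d z w + d w u" "d z w = 0 \<longleftrightarrow> z = w"
    using triangle[of z w u] by (auto simp: commute)
  show "d (Inl x) (Inl y) = dX x y" "d (Inr x) (Inr y) = dX x y"
    using assms by (simp_all add: double_metrics_def)
qed

lemma double_metrics_cross_bounded:
  assumes "d \<in> double_metrics dX"
  obtains \<epsilon> where "\<epsilon> > 0" "\<And>x y. \<epsilon> \<le> d (Inl x) (Inr y)"
proof
  show "(INF (x, y)\<in>UNIV. d (Inl x) (Inr y)) > 0"
    using assms by (simp add: double_metrics_def)
  have "bdd_below (range (\<lambda>(x, y). d (Inl x) (Inr y)))"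
    using double_metrics_nonneg[OF assms] by (intro bdd_belowI[of _ 0]) auto
  then show "(INF (x, y)\<in>UNIV. d (Inl x) (Inr y)) \<le> d (Inl u) (Inr v)" for u v
    by (rule cINF_lower2[of _ _ "(u, v)"]) auto
qed

lemma Metric_space_base:
  assumes "d \<in> double_metrics dX"
  shows "Metric_space UNIV dX"
proof
  fix x y z
  show "0 \<le> dX x y" "dX x y = dX y x" "dX x y = 0 \<longleftrightarrow> x = y" "dX x z \<le> dX x y + dX y z"
    using double_metrics_nonneg[OF assms, of "Inl x" "Inl y"]
      double_metrics_commute[OF assms, of "Inl x" "Inl y"]
      double_metrics_eq_0[OF assms, of "Inl x" "Inl y"]
      double_metrics_triangle[OF assms, of "Inl x" "Inl z" "Inl y"]
    by (simp_all add: double_metrics_Inl[OF assms])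
qed

text \<open>Up to symmetry, the last four hypotheses are exactly the triangle inequalities whose
  three points do not all lie in one copy. The bound \<epsilon> separates the copies.\<close>

lemma extend_cross_in_double_metrics:
  assumes "Metric_space UNIV dX" and "\<epsilon> > 0" and bound: "\<And>x y. \<epsilon> \<le> c x y"
    and left: "\<And>x y z. c x z \<le> dX x y + c y z" and right: "\<And>x y z. c x z \<le> c x y + dX y z"
    and left_cross: "\<And>x y z. dX x y \<le> c x z + c y z"
    and right_cross: "\<And>x y z. dX y z \<le> c x y + c x z"
  shows "extend_cross dX c \<in> double_metrics dX"
proof -
  interpret X: Metric_space UNIV dX by fact
  have X_triangle: "dX x z \<le> dX x y + dX y z" for x y z
    by (rule X.triangle) auto
  \<comment> \<open>The same inequalities read backwards, for paths that start in the second
    copy.\<close>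
  have left': "c x z \<le> c y z + dX y x" and right': "c x z \<le> dX z y + c x y" for x y z
    using left[of x z y] right[of x z y] X.commute[of x y] X.commute[of y z] by simp_all
  have pos: "0 < c x y" for x y
    using bound[of x y] \<open>\<epsilon> > 0\<close> by linarith
  have "Metric_space UNIV (extend_cross dX c)"
  proof
    fix u v w :: "'a + 'a"
    show "0 \<le> extend_cross dX c u v"
      using pos by (cases u; cases v) (auto intro: less_imp_le)
    show "extend_cross dX c u v = extend_cross dX c v u"
      by (cases u; cases v) (auto intro: X.commute)
    show "extend_cross dX c u v = 0 \<longleftrightarrow> u = v"
      using pos by (cases u; cases v) (simp_all add: pos[THEN less_imp_neq, symmetric])
    show "extend_cross dX c u w \<le> extend_cross dX c u v + extend_cross dX c v w"
      by (cases u; cases v; cases w)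
        (simp_all only: extend_cross.simps X_triangle left right left' right' left_cross right_cross)
  qed
  moreover have "(INF (x, y)\<in>UNIV. c x y) > 0"
    using \<open>\<epsilon> > 0\<close> bound by (intro less_le_trans[OF _ cINF_greatest]) auto
  ultimately show ?thesis
    unfolding double_metrics_def by simp
qed

lemma metric_unit_in_double_metrics:
  assumes "Metric_space UNIV dX"
  shows "metric_unit dX \<in> double_metrics dX"
proof -
  interpret X: Metric_space UNIV dX by fact
  have tri: "dX x z \<le> dX x y + dX y z" for x y z by (rule X.triangle) auto
  show ?thesis
    unfolding metric_unit_def
  proof (rule extend_cross_in_double_metrics[OF assms zero_less_one])
    fix x y z
    show "dX x y \<le> dX x z + 1 + (dX y z + 1)" "dX y z \<le> dX x y + 1 + (dX x z + 1)"
      using tri[of x y z] tri[of y z x] X.commute[of z y] X.commute[of x y] by simp_all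
    show "dX x z + 1 \<le> dX x y + (dX y z + 1)" "dX x z + 1 \<le> dX x y + 1 + dX y z"
      using tri[of x z y] by simp_all
  qed auto
qed

lemma metric_adj_in_double_metrics:
  assumes d: "d \<in> double_metrics dX"
  shows "metric_adj dX d \<in> double_metrics dX"
proof -
  obtain \<epsilon> where \<epsilon>: "\<epsilon> > 0" "\<And>x y. \<epsilon> \<le> d (Inl x) (Inr y)"
    using double_metrics_cross_bounded[OF d] by blast
  note tri = double_metrics_triangle[OF d] and comm = double_metrics_commute[OF d]
    and base = double_metrics_Inl[OF d, symmetric] double_metrics_Inr[OF d, symmetric]
  show ?thesis
    unfolding metric_adj_def
  proof (rule extend_cross_in_double_metrics[OF Metric_space_base[OF d] \<epsilon>(1)])
    fix x y z
    show "\<epsilon> \<le> d (Inr x) (Inl y)" using \<epsilon>(2)[of y x] comm by metis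
    show "d (Inr x) (Inl z) \<le> dX x y + d (Inr y) (Inl z)"
      "dX x y \<le> d (Inr x) (Inl z) + d (Inr y) (Inl z)"
      using tri comm base(2) by metis+
    show "d (Inr x) (Inl z) \<le> d (Inr x) (Inl y) + dX y z"
      "dX y z \<le> d (Inr x) (Inl y) + d (Inr x) (Inl z)"
      using tri comm base(1) by metis+
  qed
qed

lemma metric_comp_Inl_Inr_le:
  assumes "\<rho> \<in> double_metrics dX" "d \<in> double_metrics dX"
  shows "metric_comp dX \<rho> d (Inl x) (Inr z) \<le> d (Inl x) (Inr y) + \<rho> (Inl y) (Inr z)"
proof -
  have "bdd_below (range (\<lambda>y. d (Inl x) (Inr y) + \<rho> (Inl y) (Inr z)))"
    using double_metrics_nonneg[OF assms(1)] double_metrics_nonneg[OF assms(2)]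
    by (intro bdd_belowI[of _ 0]) (auto intro!: add_nonneg_nonneg)
  then show ?thesis
    unfolding metric_comp_def by (auto intro: cINF_lower)
qed

lemma metric_comp_Inl_Inr_greatest:
  assumes "\<And>y. t \<le> d (Inl x) (Inr y) + \<rho> (Inl y) (Inr z)"
  shows "t \<le> metric_comp dX \<rho> d (Inl x) (Inr z)"
  unfolding metric_comp_def using assms by (auto intro: cINF_greatest)

text \<open>The infimum need not be attained, so an intermediate point is available only below a
  strictly larger bound. This is the source of the slack \<open>R + 1\<close> and
  \<open>S + 1\<close> in later uses.\<close>

lemma metric_comp_Inl_Inr_approx:
  assumes "metric_comp dX \<rho> d (Inl x) (Inr z) < t"
  obtains y where "d (Inl x) (Inr y) + \<rho> (Inl y) (Inr z) < t"
  using metric_comp_Inl_Inr_greatest[of t d x \<rho> z dX] assms by (meson not_le)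

lemma metric_comp_in_double_metrics:
  assumes \<rho>: "\<rho> \<in> double_metrics dX" and d: "d \<in> double_metrics dX"
  shows "metric_comp dX \<rho> d \<in> double_metrics dX"
proof -
  define c where "c x z = metric_comp dX \<rho> d (Inl x) (Inr z)" for x z
  have c_le: "c x z \<le> d (Inl x) (Inr y) + \<rho> (Inl y) (Inr z)" for x y z
    unfolding c_def by (rule metric_comp_Inl_Inr_le[OF \<rho> d])
  have c_greatest: "t \<le> c x z" if "\<And>y. t \<le> d (Inl x) (Inr y) + \<rho> (Inl y) (Inr z)" for t x z
    unfolding c_def using that by (rule metric_comp_Inl_Inr_greatest)
  have comp_eq: "metric_comp dX \<rho> d = extend_cross dX c"
    unfolding metric_comp_def c_def by simp
  obtain \<epsilon> where \<epsilon>: "\<epsilon> > 0" "\<And>x y. \<epsilon> \<le> d (Inl x) (Inr y)"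
    using double_metrics_cross_bounded[OF d] by blast
  note tri_d = double_metrics_triangle[OF d] and tri_\<rho> = double_metrics_triangle[OF \<rho>]
    and comm_d = double_metrics_commute[OF d] and comm_\<rho> = double_metrics_commute[OF \<rho>]
    and base_d = double_metrics_Inl[OF d] double_metrics_Inr[OF d]
    and base_\<rho> = double_metrics_Inl[OF \<rho>] double_metrics_Inr[OF \<rho>]
  show ?thesis
    unfolding comp_eq
  proof (rule extend_cross_in_double_metrics[OF Metric_space_base[OF d] \<epsilon>(1)])
    fix x y z
    show "\<epsilon> \<le> c x y"
      using \<epsilon>(2) double_metrics_nonneg[OF \<rho>] by (intro c_greatest) (metis add.right_neutral add_mono)
    \<comment> \<open>Here and below, all other terms are moved to the left, so that a single
      infimum stands on the right and \<open>c_greatest\<close> reduces it to one intermediate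
      point.\<close>
    have "c x z - dX x y \<le> c y z"
    proof (rule c_greatest)
      fix u
      show "c x z - dX x y \<le> d (Inl y) (Inr u) + \<rho> (Inl u) (Inr z)"
        using c_le[of x z u] tri_d[of "Inl x" "Inr u" "Inl y"] base_d(1)[of x y] by linarith
    qed
    then show "c x z \<le> dX x y + c y z" by simp
    have "c x z - dX y z \<le> c x y"
    proof (rule c_greatest)
      fix u
      show "c x z - dX y z \<le> d (Inl x) (Inr u) + \<rho> (Inl u) (Inr y)"
        using c_le[of x z u] tri_\<rho>[of "Inl u" "Inr z" "Inr y"] base_\<rho>(2)[of y z] by linarith
    qed
    then show "c x z \<le> c x y + dX y z" by simp
    \<comment> \<open>Two infima occur, hence two nested uses of \<open>c_greatest\<close>. The path
      runs from x to u' and from v' to y in d; the gap between u' and v' equals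
      \<open>dX u v\<close>, which is also the distance of u and v in \<rho>, where both connect to
      z'.\<close>
    have "dX x y - c y z \<le> c x z"
    proof (rule c_greatest)
      fix u
      have "dX x y - (d (Inl x) (Inr u) + \<rho> (Inl u) (Inr z)) \<le> c y z"
      proof (rule c_greatest)
        fix v
        show "dX x y - (d (Inl x) (Inr u) + \<rho> (Inl u) (Inr z)) \<le>
            d (Inl y) (Inr v) + \<rho> (Inl v) (Inr z)"
          using tri_d[of "Inl x" "Inl y" "Inr u"] tri_d[of "Inr u" "Inl y" "Inr v"]
            tri_\<rho>[of "Inl u" "Inl v" "Inr z"] comm_\<rho>[of "Inl v" "Inr z"]
            comm_d[of "Inl y" "Inr v"] base_d(1)[of x y] base_d(2)[of u v] base_\<rho>(1)[of u v]
          by linarith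
      qed
      then show "dX x y - c y z \<le> d (Inl x) (Inr u) + \<rho> (Inl u) (Inr z)" by simp
    qed
    then show "dX x y \<le> c x z + c y z" by simp
    \<comment> \<open>The mirrored path: its outer edges lie in \<rho>, and the gap between u and v
      is bridged in d through x.\<close>
    have "dX y z - c x z \<le> c x y"
    proof (rule c_greatest)
      fix u
      have "dX y z - (d (Inl x) (Inr u) + \<rho> (Inl u) (Inr y)) \<le> c x z"
      proof (rule c_greatest)
        fix v
        show "dX y z - (d (Inl x) (Inr u) + \<rho> (Inl u) (Inr y)) \<le>
            d (Inl x) (Inr v) + \<rho> (Inl v) (Inr z)"
          using tri_\<rho>[of "Inr y" "Inr z" "Inl u"] tri_\<rho>[of "Inl u" "Inr z" "Inl v"]
            tri_d[of "Inr u" "Inr v" "Inl x"] comm_d[of "Inl x" "Inr u"]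
            comm_\<rho>[of "Inr y" "Inl u"] base_\<rho>(2)[of y z] base_d(2)[of u v] base_\<rho>(1)[of u v]
          by linarith
      qed
      then show "dX y z - c x z \<le> d (Inl x) (Inr u) + \<rho> (Inl u) (Inr y)" by simp
    qed
    then show "dX y z \<le> c x y + c x z" by simp
  qed
qed

section \<open>Coarse classes and the products of s with its pseudo-inverse\<close>

lemma coarse_rel_iff:
  "(d, b) \<in> coarse_rel dX \<longleftrightarrow>
     d \<in> double_metrics dX \<and> b \<in> double_metrics dX \<and> controlled b d \<and> controlled d b"
  unfolding coarse_rel_def
  using coarsely_equivalent_imp_controlled[of b d] controlled_imp_coarsely_equivalent[of b d]
    double_metrics_nonneg[of d dX] double_metrics_nonneg[of b dX]
  by auto

lemma equiv_coarse_rel: "equiv (double_metrics dX) (coarse_rel dX)"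
proof (rule equivI)
  show "trans (coarse_rel dX)"
    by (rule transI) (meson coarse_rel_iff controlled_trans)
qed (auto simp: refl_on_def sym_def coarse_rel_iff controlled_refl)

text \<open>Inside either copy both metrics equal \<open>dX\<close>, and distances from the second
  copy to the first are cross distances by symmetry.\<close>

lemma controlled_crossI:
  assumes d: "d \<in> double_metrics dX" and b: "b \<in> double_metrics dX"
    and cross: "\<And>R. \<exists>S. \<forall>x y. d (Inl x) (Inr y) \<le> R \<longrightarrow> b (Inl x) (Inr y) \<le> S"
  shows "controlled b d"
  unfolding controlled_def
proof
  fix R
  obtain S where S: "\<And>x y. d (Inl x) (Inr y) \<le> R \<Longrightarrow> b (Inl x) (Inr y) \<le> S"
    using cross by metis
  have "b z w \<le> max R S" if zw: "d z w \<le> R" for z w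
  proof (cases z; cases w)
    fix x y assume "z = Inr x" "w = Inl y"
    then show ?thesis
      using zw S[of y x] double_metrics_commute[OF d, of z] double_metrics_commute[OF b, of z]
      by simp
  qed (use zw S in \<open>auto simp: double_metrics_Inl[OF d] double_metrics_Inr[OF d]
        double_metrics_Inl[OF b] double_metrics_Inr[OF b] le_max_iff_disj\<close>)
  then show "\<exists>S. \<forall>z w. d z w \<le> R \<longrightarrow> b z w \<le> S" by blast
qed

lemma controlled_adj:
  assumes d: "d \<in> double_metrics dX" and b: "b \<in> double_metrics dX" and "controlled b d"
  shows "controlled (metric_adj dX b) (metric_adj dX d)"
proof (rule controlled_crossI[OF metric_adj_in_double_metrics[OF d] metric_adj_in_double_metrics[OF b]])
  show "\<exists>S. \<forall>x y. metric_adj dX d (Inl x) (Inr y) \<le> R \<longrightarrow> metric_adj dX b (Inl x) (Inr y) \<le> S" for R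
    using controlledD[OF assms(3), of R] unfolding metric_adj_def extend_cross.simps by metis
qed

text \<open>The half of \<open>s s* = 1\<close> that uses density. If x is near z, a point y that is
  \<rho>-near z' is also \<rho>-near x'. Hence y' is near x in the adjoint of \<rho>, thus in d, and
  the composite path from x through y to z' is short.\<close>

lemma controlled_metric_comp_unit:
  assumes \<rho>: "\<rho> \<in> double_metrics dX" and d: "d \<in> double_metrics dX"
    and adj: "controlled d (metric_adj dX \<rho>)"
    and dense: "\<And>y. \<exists>x. \<rho> (Inl x) (Inr y) \<le> C"
  shows "controlled (metric_comp dX \<rho> d) (metric_unit dX)"
proof (rule controlled_crossI[OF metric_unit_in_double_metrics[OF Metric_space_base[OF d]]
      metric_comp_in_double_metrics[OF \<rho> d]])
  fix R
  obtain S where S: "\<And>z w. metric_adj dX \<rho> z w \<le> C + R \<Longrightarrow> d z w \<le> S"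
    using controlledD[OF adj] by metis
  have "metric_comp dX \<rho> d (Inl x) (Inr z) \<le> S + C" if "metric_unit dX (Inl x) (Inr z) \<le> R" for x z
  proof -
    obtain y where y: "\<rho> (Inl y) (Inr z) \<le> C" using dense by blast
    have "dX x z \<le> R" using that by (simp add: metric_unit_def)
    then have "\<rho> (Inr x) (Inl y) \<le> C + R"
      using double_metrics_triangle[OF \<rho>, of "Inr x" "Inl y" "Inr z"] y
        double_metrics_Inr[OF \<rho>, of x z] double_metrics_commute[OF \<rho>, of "Inl y" "Inr z"] by linarith
    then have "d (Inl x) (Inr y) \<le> S"
      using S[of "Inl x" "Inr y"] by (simp add: metric_adj_def)
    then show ?thesis
      using metric_comp_Inl_Inr_le[OF \<rho> d, of x z y] y by linarith
  qed
  then show "\<exists>S. \<forall>x y. metric_unit dX (Inl x) (Inr y) \<le> R \<longrightarrow> metric_comp dX \<rho> d (Inl x) (Inr y) \<le> S"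
    by blast
qed

text \<open>A short composite path from x to z' has an intermediate y that is \<rho>-near both x'
  and z', so x and z are near each other in X.\<close>

lemma controlled_unit_metric_comp:
  assumes \<rho>: "\<rho> \<in> double_metrics dX" and d: "d \<in> double_metrics dX"
    and adj: "controlled (metric_adj dX \<rho>) d"
  shows "controlled (metric_unit dX) (metric_comp dX \<rho> d)"
proof (rule controlled_crossI[OF metric_comp_in_double_metrics[OF \<rho> d]
      metric_unit_in_double_metrics[OF Metric_space_base[OF d]]])
  fix R
  obtain S where S: "\<And>z w. d z w \<le> R + 1 \<Longrightarrow> metric_adj dX \<rho> z w \<le> S"
    using controlledD[OF adj] by metis
  have "metric_unit dX (Inl x) (Inr z) \<le> S + R + 2" if "metric_comp dX \<rho> d (Inl x) (Inr z) \<le> R" for x z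
  proof -
    have "metric_comp dX \<rho> d (Inl x) (Inr z) < R + 1" using that by simp
    then obtain y where y: "d (Inl x) (Inr y) + \<rho> (Inl y) (Inr z) < R + 1"
      by (rule metric_comp_Inl_Inr_approx)
    then have "d (Inl x) (Inr y) \<le> R + 1" "\<rho> (Inl y) (Inr z) \<le> R + 1"
      using double_metrics_nonneg[OF \<rho>, of "Inl y" "Inr z"]
        double_metrics_nonneg[OF d, of "Inl x" "Inr y"] by linarith+
    moreover from this(1) have "\<rho> (Inr x) (Inl y) \<le> S"
      using S[of "Inl x" "Inr y"] by (simp add: metric_adj_def)
    ultimately show ?thesis
      using double_metrics_triangle[OF \<rho>, of "Inr x" "Inr z" "Inl y"]
        double_metrics_Inr[OF \<rho>, of x z] by (simp add: metric_unit_def)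
  qed
  then show "\<exists>S. \<forall>x y. metric_comp dX \<rho> d (Inl x) (Inr y) \<le> R \<longrightarrow> metric_unit dX (Inl x) (Inr y) \<le> S"
    by blast
qed

text \<open>The product is a union over representatives, so every pair \<rho>, d must be shown to
  give the class of the unit. Density passes from \<open>d\<^sub>0\<close> to any \<rho> in s with a
  new constant, since \<rho> is controlled by \<open>d\<^sub>0\<close>.\<close>

lemma class_mult_star_eq_one:
  assumes s: "s \<in> coarse_semigroup dX" and "d\<^sub>0 \<in> s"
    and dense: "\<And>y. \<exists>x. d\<^sub>0 (Inl x) (Inr y) \<le> C"
  shows "class_mult dX s (class_star dX s) = class_one dX"
proof -
  have related: "(d, b) \<in> coarse_rel dX" if "d \<in> s" "b \<in> s" for d b
    using s that quotient_eq_iff[OF equiv_coarse_rel, of s dX s d b]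
    unfolding coarse_semigroup_def by blast
  have classes_eq: "coarse_class dX (metric_comp dX \<rho> d) = class_one dX"
    if "\<rho> \<in> s" and star: "d \<in> class_star dX s" for \<rho> d
  proof -
    obtain b where "b \<in> s" and bd: "(metric_adj dX b, d) \<in> coarse_rel dX"
      using star unfolding class_star_def coarse_class_def by blast
    have \<rho>: "\<rho> \<in> double_metrics dX" and d: "d \<in> double_metrics dX"
      and b: "b \<in> double_metrics dX"
      using related[OF \<open>\<rho> \<in> s\<close> \<open>b \<in> s\<close>] bd by (auto simp: coarse_rel_iff)
    have "controlled (metric_adj dX b) (metric_adj dX \<rho>)" "controlled (metric_adj dX \<rho>) (metric_adj dX b)"
      using related[OF \<open>\<rho> \<in> s\<close> \<open>b \<in> s\<close>] controlled_adj[OF \<rho> b] controlled_adj[OF b \<rho>]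
      by (auto simp: coarse_rel_iff)
    then have adj: "controlled d (metric_adj dX \<rho>)" "controlled (metric_adj dX \<rho>) d"
      using bd controlled_trans by (auto simp: coarse_rel_iff)
    obtain S where "\<And>z w. d\<^sub>0 z w \<le> C \<Longrightarrow> \<rho> z w \<le> S"
      using related[OF \<open>d\<^sub>0 \<in> s\<close> \<open>\<rho> \<in> s\<close>] controlledD[of \<rho> d\<^sub>0] by (auto simp: coarse_rel_iff)
    then have "\<And>y. \<exists>x. \<rho> (Inl x) (Inr y) \<le> S"
      using dense by blast
    from controlled_metric_comp_unit[OF \<rho> d adj(1) this]
    have "(metric_comp dX \<rho> d, metric_unit dX) \<in> coarse_rel dX"
      using controlled_unit_metric_comp[OF \<rho> d adj(2)]
        metric_comp_in_double_metrics[OF \<rho> d] metric_unit_in_double_metrics[OF Metric_space_base[OF d]]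
      by (simp add: coarse_rel_iff)
    then show ?thesis
      unfolding coarse_class_def class_one_def by (rule equiv_class_eq[OF equiv_coarse_rel])
  qed
  \<comment> \<open>The union must also be nonempty for it to equal the common class.\<close>
  have "metric_adj dX d\<^sub>0 \<in> class_star dX s"
    using \<open>d\<^sub>0 \<in> s\<close> related[OF \<open>d\<^sub>0 \<in> s\<close> \<open>d\<^sub>0 \<in> s\<close>]
    by (auto simp: class_star_def coarse_class_def coarse_rel_iff metric_adj_in_double_metrics
        controlled_refl intro!: bexI[of _ d\<^sub>0])
  then show ?thesis
    unfolding class_mult_def using classes_eq \<open>d\<^sub>0 \<in> s\<close> by blast
qed

text \<open>In the unit metric x and x' have distance 1. A composite \<rho> o d equivalent to it
  therefore keeps x and x' at bounded distance, and the intermediate point of a nearly optimal path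
  is the wanted y.\<close>

lemma class_mult_star_one_imp_dense:
  assumes s: "s \<in> coarse_semigroup dX"
    and one: "class_mult dX (class_star dX s) s = class_one dX"
  obtains d C where "d \<in> s" "d \<in> double_metrics dX" "\<And>x. \<exists>y. d (Inl x) (Inr y) \<le> C"
proof -
  have sub: "d \<in> double_metrics dX" if "d \<in> s" for d
    using s that in_quotient_imp_subset[OF equiv_coarse_rel]
    unfolding coarse_semigroup_def by blast
  obtain d\<^sub>0 where "d\<^sub>0 \<in> s"
    using s in_quotient_imp_non_empty[OF equiv_coarse_rel] unfolding coarse_semigroup_def by blast
  have metric: "Metric_space UNIV dX"
    using sub[OF \<open>d\<^sub>0 \<in> s\<close>] by (rule Metric_space_base)
  then have "metric_unit dX \<in> class_one dX"
    by (simp add: class_one_def coarse_class_def coarse_rel_iff metric_unit_in_double_metrics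
        controlled_refl)
  then obtain \<rho> d where "\<rho> \<in> class_star dX s" "d \<in> s"
    and rel: "(metric_comp dX \<rho> d, metric_unit dX) \<in> coarse_rel dX"
    unfolding one[symmetric] class_mult_def coarse_class_def by auto
  have \<rho>: "\<rho> \<in> double_metrics dX"
    using \<open>\<rho> \<in> class_star dX s\<close> by (auto simp: class_star_def coarse_class_def coarse_rel_iff)
  obtain S where S: "\<And>z w. metric_unit dX z w \<le> 1 \<Longrightarrow> metric_comp dX \<rho> d z w \<le> S"
    using rel controlledD by (metis coarse_rel_iff)
  have "\<exists>y. d (Inl x) (Inr y) \<le> S + 1" for x
  proof -
    have "dX x x = 0" using Metric_space.zero[OF metric] by simp
    then have "metric_comp dX \<rho> d (Inl x) (Inr x) < S + 1"
      using S[of "Inl x" "Inr x"] by (simp add: metric_unit_def)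
    then obtain y where "d (Inl x) (Inr y) + \<rho> (Inl y) (Inr x) < S + 1"
      by (rule metric_comp_Inl_Inr_approx)
    then show ?thesis
      using double_metrics_nonneg[OF \<rho>, of "Inl y" "Inr x"] by (intro exI[of _ y]) linarith
  qed
  then show thesis using that \<open>d \<in> s\<close> sub by blast
qed

section \<open>Rough isometries of a doubling group with invariant metric\<close>

lemma rough_isometry_coarsely_surjective:
  fixes f :: "'a::ab_group_add \<Rightarrow> 'a"
  assumes "Metric_space UNIV \<rho>"
    and translation: "\<And>x y z. \<rho> (x + z) (y + z) = \<rho> x y"
    and doubling: "\<And>r c (a :: nat \<Rightarrow> 'a). 0 < r \<Longrightarrow> (\<And>j. j \<le> M \<Longrightarrow> \<rho> c (a j) \<le> 3 * r) \<Longrightarrow>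
      \<exists>j k. j < k \<and> k \<le> M \<and> \<rho> (a j) (a k) < r / 2"
    and rough: "\<And>x y. \<bar>\<rho> (f x) (f y) - \<rho> x y\<bar> \<le> K"
  shows "\<exists>D. \<forall>y. \<exists>x. \<rho> (f x) y \<le> D"
proof (rule ccontr)
  interpret Metric_space UNIV \<rho> by fact
  assume far: "\<not> ?thesis"
  have "0 \<le> K" using rough[of 0 0] by linarith
  \<comment> \<open>At most M iterations will be made, each with error at most K;
    \<open>D \<le> r\<close> keeps the total error within \<open>r / 2\<close>. As M in
    \<open>doubling\<close> does not depend on r, D can be fixed before y and r. The summand 1 makes
    D positive.\<close>
  define D where "D = 2 * real M * K + 1"
  have "0 < D" using \<open>0 \<le> K\<close> by (simp add: D_def add_nonneg_pos)
  obtain y where y: "\<And>x. D < \<rho> (f x) y"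
    using far by (meson not_le)
  define r where "r = (INF x. \<rho> (f x) y)"
  have "bdd_below (range (\<lambda>x. \<rho> (f x) y))"
    by (intro bdd_belowI[of _ 0]) auto
  then have r_le: "r \<le> \<rho> (f x) y" for x
    unfolding r_def by (rule cINF_lower) simp
  have "D \<le> r"
    unfolding r_def using y by (intro cINF_greatest) (auto intro: less_imp_le)
  then have "0 < r" using \<open>0 < D\<close> by linarith
  have "\<exists>x. \<rho> (f x) y < 2 * r"
  proof (rule ccontr)
    assume "\<not> ?thesis"
    then have "2 * r \<le> (INF x. \<rho> (f x) y)"
      by (intro cINF_greatest) (auto simp: not_less)
    then show False using \<open>0 < r\<close> unfolding r_def[symmetric] by simp
  qed
  then obtain x\<^sub>0 where x\<^sub>0: "\<rho> (f x\<^sub>0) y < 2 * r" by blast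
  \<comment> \<open>Both f and y are shifted by the translation taking \<open>f x\<^sub>0\<close> to
    \<open>x\<^sub>0\<close>. By invariance h is as rough as f, and z is as far from the image of h
    as y from that of f.\<close>
  define h where "h x = f x + (x\<^sub>0 - f x\<^sub>0)" for x
  define z where "z = y + (x\<^sub>0 - f x\<^sub>0)"
  define a where "a k = (h ^^ k) z" for k
  have h_rough: "\<bar>\<rho> (h u) (h v) - \<rho> u v\<bar> \<le> K" for u v
    using rough by (simp add: h_def translation)
  have h_fixed: "h x\<^sub>0 = x\<^sub>0" by (simp add: h_def)
  have a_Suc: "a (Suc k) = h (a k)" for k by (simp add: a_def)
  \<comment> \<open>As \<open>x\<^sub>0\<close> is fixed by h, each iteration changes the distance
    to it by at most K.\<close>
  have near: "\<rho> x\<^sub>0 (a k) \<le> 2 * r + real k * K" for k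
  proof (induction k)
    case 0
    have "\<rho> (h x\<^sub>0) z = \<rho> (f x\<^sub>0) y"
      unfolding h_def z_def by (rule translation)
    then show ?case using x\<^sub>0 h_fixed by (simp add: a_def)
  next
    case (Suc k)
    then show ?case
      using h_rough[of x\<^sub>0 "a k"] h_fixed by (simp add: a_Suc algebra_simps)
  qed
  \<comment> \<open>For j = 0 the later point lies in the image of h, hence at distance at least r
    from z. Applying h to both points j times loses at most K each time.\<close>
  have separated: "r - real j * K \<le> \<rho> (a j) (a (j + Suc k))" for j k
  proof (induction j)
    case 0
    have "\<rho> (h (a k)) z = \<rho> (f (a k)) y"
      unfolding h_def z_def by (rule translation)
    then show ?case using r_le[of "a k"] commute by (simp add: a_def)
  next
    case (Suc j)
    then show ?case
      using h_rough[of "a j" "a (j + Suc k)"] by (simp add: a_Suc algebra_simps)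
  qed
  have small: "real j * K \<le> r / 2" if "j \<le> M" for j
  proof -
    have "real j * K \<le> real M * K" using that \<open>0 \<le> K\<close> by (simp add: mult_right_mono)
    then show ?thesis using \<open>D \<le> r\<close> by (simp add: D_def)
  qed
  have within: "\<rho> x\<^sub>0 (a j) \<le> 3 * r" if "j \<le> M" for j
    using near[of j] small[OF that] \<open>0 < r\<close> by linarith
  have "\<exists>j k. j < k \<and> k \<le> M \<and> \<rho> (a j) (a k) < r / 2"
    by (rule doubling[where c = x\<^sub>0]) (use within \<open>0 < r\<close> in auto)
  then obtain j k where "j < k" "k \<le> M" and less: "\<rho> (a j) (a k) < r / 2"
    by (elim exE conjE)
  then obtain i where k: "k = j + Suc i" using less_imp_Suc_add by fastforce
  then show False
    using separated[of j i] small[of j] less \<open>k \<le> M\<close> unfolding k by simp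
qed

section \<open>Packing in the integer lattice with an l_p-distance\<close>

lemma lp_dist_translation: "lp_dist p (x + z) (y + z) = lp_dist p x y"
  by (simp add: lp_dist_def)

lemma abs_component_le_lp_dist:
  assumes "1 \<le> p"
  shows "\<bar>real_of_int (x $ i - y $ i)\<bar> \<le> lp_dist p x y"
proof (cases "p = \<infinity>")
  case True
  then show ?thesis by (simp add: lp_dist_def)
next
  case False
  define q where "q = real_of_ereal p"
  have "1 \<le> q" using assms False unfolding q_def by (cases p) auto
  let ?u = "\<lambda>i. \<bar>real_of_int (x $ i - y $ i)\<bar>"
  have "?u i = (?u i powr q) powr (1 / q)"
    using \<open>1 \<le> q\<close> by (simp add: powr_powr)
  also have "\<dots> \<le> (\<Sum>i\<in>UNIV. ?u i powr q) powr (1 / q)"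
    using \<open>1 \<le> q\<close> by (intro powr_mono2 member_le_sum) auto
  finally show ?thesis using False by (simp add: lp_dist_def q_def)
qed

text \<open>Together with the preceding lemma this compares every l_p-distance with the maximum
  distance, with a constant independent of p: the factor \<open>CARD('n) powr (1 / q)\<close> is at
  most \<open>CARD('n)\<close>.\<close>

lemma lp_dist_le_card_mult:
  fixes x y :: "int ^ 'n"
  assumes "1 \<le> p" and t: "\<And>i. \<bar>real_of_int (x $ i - y $ i)\<bar> \<le> t"
  shows "lp_dist p x y \<le> real CARD('n) * t"
proof -
  have "0 \<le> t" using t abs_ge_zero order_trans by blast
  have card: "1 \<le> real CARD('n)" by (simp add: Suc_leI)
  show ?thesis
  proof (cases "p = \<infinity>")
    case True
    then have "lp_dist p x y \<le> t" using t by (simp add: lp_dist_def)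
    then show ?thesis using mult_right_mono[OF card \<open>0 \<le> t\<close>] by simp
  next
    case False
    define q where "q = real_of_ereal p"
    have "1 \<le> q" using assms False unfolding q_def by (cases p) auto
    let ?u = "\<lambda>i. \<bar>real_of_int (x $ i - y $ i)\<bar>"
    have "(\<Sum>i\<in>UNIV. ?u i powr q) \<le> (\<Sum>i\<in>(UNIV :: 'n set). t powr q)"
      using \<open>1 \<le> q\<close> t by (intro sum_mono powr_mono2) auto
    then have "(\<Sum>i\<in>UNIV. ?u i powr q) powr (1 / q) \<le> (real CARD('n) * t powr q) powr (1 / q)"
      using \<open>1 \<le> q\<close> by (intro powr_mono2) (auto intro: sum_nonneg)
    also have "\<dots> = real CARD('n) powr (1 / q) * t"
      using \<open>1 \<le> q\<close> \<open>0 \<le> t\<close> by (simp add: powr_mult powr_powr)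
    also have "\<dots> \<le> real CARD('n) powr 1 * t"
      using \<open>1 \<le> q\<close> \<open>0 \<le> t\<close> card by (intro mult_right_mono powr_mono) auto
    finally show ?thesis using False by (simp add: lp_dist_def q_def)
  qed
qed

text \<open>Pigeonhole on a grid of cubes centred relative to c. The number M of cubes does not
  depend on r, c or p, as the iteration argument requires.\<close>

lemma lp_dist_doubling:
  fixes c :: "int ^ 'n" and a :: "nat \<Rightarrow> int ^ 'n"
  defines "M \<equiv> (24 * CARD('n) + 1) ^ CARD('n)"
  assumes "1 \<le> p" "0 < r" and near: "\<And>j. j \<le> M \<Longrightarrow> lp_dist p c (a j) \<le> 3 * r"
  shows "\<exists>j k. j < k \<and> k \<le> M \<and> lp_dist p (a j) (a k) < r / 2"
proof -
  define n where "n = CARD('n)"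
  \<comment> \<open>With this side length, 3 r equals 12 n t, so each coordinate has 24 n + 1
    possible floors, and two points in one cube are at distance at most n t = r / 4.\<close>
  define t where "t = r / (4 * real n)"
  have "0 < n" by (simp add: n_def)
  then have "0 < t" using \<open>0 < r\<close> by (simp add: t_def)
  define cell where "cell j = (\<lambda>i. \<lfloor>real_of_int (a j $ i - c $ i) / t\<rfloor>)" for j
  \<comment> \<open>Over the domain \<open>UNIV\<close> extensionality is no restriction, so
    \<open>cell j\<close> itself can belong to B.\<close>
  define B where "B = (UNIV :: 'n set) \<rightarrow>\<^sub>E {- int (12 * n)..int (12 * n)}"
  have "finite B" unfolding B_def by (intro finite_PiE) auto
  have "card B = M"
    unfolding B_def M_def n_def[symmetric] by (simp add: card_PiE n_def[symmetric] nat_add_distrib nat_mult_distrib)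
  have "cell j \<in> B" if "j \<le> M" for j
  proof -
    have "\<bar>real_of_int (a j $ i - c $ i) / t\<bar> \<le> real (12 * n)" for i
    proof -
      have "\<bar>real_of_int (a j $ i - c $ i)\<bar> \<le> 3 * r"
        using abs_component_le_lp_dist[OF \<open>1 \<le> p\<close>, of c i "a j"] near[OF that] by simp
      also have "\<dots> = real (12 * n) * t" using \<open>0 < n\<close> by (simp add: t_def)
      finally show ?thesis using \<open>0 < t\<close> by (simp add: abs_divide pos_divide_le_eq)
    qed
    then have "- real (12 * n) \<le> real_of_int (a j $ i - c $ i) / t"
      "real_of_int (a j $ i - c $ i) / t \<le> real (12 * n)" for i
      by (simp_all only: abs_le_iff) (metis minus_le_iff)
    then have "cell j i \<in> {- int (12 * n)..int (12 * n)}" for i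
      unfolding cell_def atLeastAtMost_iff le_floor_iff
      by (intro conjI) (simp, metis floor_mono floor_of_nat)
    then show ?thesis by (auto simp: B_def PiE_UNIV_domain)
  qed
  then have "cell ` {..M} \<subseteq> B" by auto
  \<comment> \<open>The indices 0 to M are M + 1 in number, one more than the cubes.\<close>
  then have "card (cell ` {..M}) < card {..M}"
    using card_mono[OF \<open>finite B\<close>] \<open>card B = M\<close> by (metis card_atMost le_imp_less_Suc)
  then have "\<not> inj_on cell {..M}" by (rule pigeonhole)
  then obtain j k where jk: "j < k" "k \<le> M" and eq: "cell j = cell k"
    unfolding inj_on_def by (metis atMost_iff linorder_neqE_nat)
  have "\<bar>real_of_int (a j $ i - a k $ i)\<bar> \<le> t" for i
  proof -
    have "\<lfloor>real_of_int (a j $ i - c $ i) / t\<rfloor> = \<lfloor>real_of_int (a k $ i - c $ i) / t\<rfloor>"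
      using fun_cong[OF eq, of i] by (simp add: cell_def)
    then have "\<bar>real_of_int (a j $ i - c $ i) / t - real_of_int (a k $ i - c $ i) / t\<bar> \<le> 1"
      by linarith
    then have "\<bar>real_of_int (a j $ i - a k $ i) / t\<bar> \<le> 1"
      by (simp add: diff_divide_distrib)
    then show ?thesis using \<open>0 < t\<close> by (simp add: abs_divide)
  qed
  from lp_dist_le_card_mult[OF \<open>1 \<le> p\<close> this] have "lp_dist p (a j) (a k) \<le> real n * t"
    by (simp add: n_def)
  also have "\<dots> < r / 2" using \<open>0 < n\<close> \<open>0 < r\<close> by (simp add: t_def)
  finally show ?thesis using jk by blast
qed

theorem corollary4p2:
  fixes p :: ereal and s :: "(int ^ 'n) double_dist set"
  assumes "1 \<le> p"
    and "s \<in> coarse_semigroup (lp_dist p)"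
    and "class_mult (lp_dist p) (class_star (lp_dist p) s) s = class_one (lp_dist p)"
  shows "class_mult (lp_dist p) s (class_star (lp_dist p) s) = class_one (lp_dist p)"
proof -
  obtain d C where "d \<in> s" and d: "d \<in> double_metrics (lp_dist p)"
    and C: "\<And>x. \<exists>y. d (Inl x) (Inr y) \<le> C"
    using class_mult_star_one_imp_dense[OF assms(2,3)] by metis
  then obtain f where f: "\<And>x. d (Inl x) (Inr (f x)) \<le> C" by metis
  note tri = double_metrics_triangle[OF d] and comm = double_metrics_commute[OF d]
    and base = double_metrics_Inl[OF d] double_metrics_Inr[OF d]
  \<comment> \<open>Replacing x by (f x)' and y by (f y)' costs at most C each, and d restricts to
    the l_p-distance on both copies.\<close>
  have rough: "\<bar>lp_dist p (f x) (f y) - lp_dist p x y\<bar> \<le> 2 * C" for x y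
    using tri[of "Inl x" "Inl y" "Inr (f x)"] tri[of "Inr (f x)" "Inl y" "Inr (f y)"]
      tri[of "Inr (f x)" "Inr (f y)" "Inl x"] tri[of "Inl x" "Inr (f y)" "Inl y"]
      comm[of "Inr (f x)" "Inl x"] comm[of "Inr (f y)" "Inl y"]
      f[of x] f[of y] base(1)[of x y] base(2)[of "f x" "f y"] by linarith
  have "\<exists>D. \<forall>y. \<exists>x. lp_dist p (f x) y \<le> D"
    using Metric_space_base[OF d] lp_dist_translation lp_dist_doubling[OF \<open>1 \<le> p\<close>] rough
    by (rule rough_isometry_coarsely_surjective)
  then obtain D where D: "\<And>y. \<exists>x. lp_dist p (f x) y \<le> D" by blast
  have "\<exists>x. d (Inl x) (Inr y) \<le> C + D" for y
  proof -
    obtain x where "lp_dist p (f x) y \<le> D" using D by blast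
    then have "d (Inl x) (Inr y) \<le> C + D"
      using tri[of "Inl x" "Inr y" "Inr (f x)"] f[of x] base(2)[of "f x" y] by linarith
    then show ?thesis ..
  qed
  then show ?thesis by (rule class_mult_star_eq_one[OF assms(2) \<open>d \<in> s\<close>])
qed

end
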